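(* Let $F(z)=\frac1n\sum_{i=1}^nH_i(z)$ with $H_i=\frac1{m_i}\sum_{j=1}^{m_i}F_{i,j}$, $F_{i,j}:\mathbb{R}^{d'}\to\mathbb{R}^{d'}$. Suppose the problem of finding $z_*$ with $\langle F(z_* ),z-z_*\rangle\ge0$ for all $z\in\mathbb{R}^{d'}$ has a unique solution $z_*$; each $H_i$ is $\mu$-quasi-strongly monotone around $z_*$, i.e. $\langle H_i(y)-H_i(z_* ),y-z_*\rangle\ge\mu\|y-z_*\|^2$ for all $y\in\mathbb{R}^{d'}$ ($\mu>0$); and for each $i$ and all $y\in\mathbb{R}^{d'}$ $$\frac1{m_i}\sum_{j=1}^{m_i}\|F_{i,j}(y)-F_{i,j}(z_* )\|^2\le\widehat\ell\,\langle H_i(y)-H_i(z_* ),y-z_*\rangle.$$ Then, for suitable choices of the parameters, the iterates of ProxSkip-L-SVRGDA-FL achieve $\mathbb{E}[V_K]\le\epsilon$ with iteration complexity $\mathcal O\left(\frac{\widehat\ell}{\mu}\ln\frac1\epsilon\right)$ and communication complexity $\mathcal O\left(\sqrt{\frac{\widehat\ell}{\mu}}\,\ln\frac1\epsilon\right)$.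
   Context: ProxSkip-L-SVRGDA-FL: given $x_{i,0}\in\mathbb{R}^{d'}$, $h_{i,0}=0$, $w_{i,0}=x_{i,0}$ ($i=1,\dots,n$), $\gamma>0$, $p,q\in(0,1]$. For $k=0,1,\dots$: flip independent coins $\theta_k,\zeta_k$ (common to all clients) with $\mathbb{P}(\theta_k=1)=p$, $\mathbb{P}(\zeta_k=1)=q$; each client $i$ draws $j_k\sim\mathrm{Unif}\{1,\dots,m_i\}$ and sets $g_{i,k}=F_{i,j_k}(x_{i,k})-F_{i,j_k}(w_{i,k})+H_i(w_{i,k})$; $w_{i,k+1}=x_{i,k}$ if $\zeta_k=1$ and $w_{i,k+1}=w_{i,k}$ otherwise; $\widehat x_{i,k+1}=x_{i,k}-\gamma(g_{i,k}-h_{i,k})$; if $\theta_k=1$ (a communication round) $x_{i,k+1}=\frac1n\sum_{l=1}^n\left(\widehat x_{l,k+1}-\frac\gamma ph_{l,k}\right)$ for all $i$, otherwise $x_{i,k+1}=\widehat x_{i,k+1}$; then $h_{i,k+1}=h_{i,k}+\frac p\gamma(x_{i,k+1}-\widehat x_{i,k+1})$. Notation: $V_k=\sum_{i=1}^n\|x_{i,k}-z_*\|^2+\frac{\gamma^2}{p^2}\sum_{i=1}^n\|h_{i,k}-H_i(z_* )\|^2+M\gamma^2\sigma_k^2$, where $\sigma_k^2=\sum_{i=1}^n\frac1{m_i}\sum_{j=1}^{m_i}\|F_{i,j}(w_{i,k})-F_{i,j}(z_* )\|^2$ and $M>0$ is a parameter of the analysis; the parameters to be chosen are $\gamma,p,q,M$.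 Iteration complexity is the number $K$ of iterations sufficient for $\mathbb{E}[V_K]\le\epsilon$; communication complexity is the corresponding expected number $pK$ of rounds with $\theta_k=1$. $\mathcal O(\cdot)$ hides absolute numerical constants, and the dependence on $V_0$ inside the logarithm ($\ln\frac1\epsilon$ stands for $\ln\frac{2V_0}\epsilon$). *)

theory Defs
  imports "HOL-Probability.Probability" "HOL-Library.Function_Algebras"
begin

text \<open>
  Vectors of variable dimension. The dimension has to be quantified inside the theorem, below
  the absolute constant hidden by the O-notation, so it cannot be a type. The space
  \<open>\<real>\<^sup>d\<close> is \<open>topspace (Euclidean_space d)\<close>: the sequences of reals vanishing from
  index \<open>d\<close> on. Vector operations are the pointwise ones.
\<close>

type_synonym rvec = "nat \<Rightarrow> real"

instantiation "fun" :: (type, real_vector) real_vector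
begin

definition scaleR_fun :: "real \<Rightarrow> ('a \<Rightarrow> 'b) \<Rightarrow> 'a \<Rightarrow> 'b"
  where "scaleR_fun a f = (\<lambda>c. a *\<^sub>R f c)"

instance
  by standard (auto simp: scaleR_fun_def fun_eq_iff scaleR_add_right scaleR_add_left)

end

abbreviation R_space :: "nat \<Rightarrow> rvec set"
  where "R_space d \<equiv> topspace (Euclidean_space d)"

definition inner_d :: "nat \<Rightarrow> rvec \<Rightarrow> rvec \<Rightarrow> real"
  where "inner_d d x y = (\<Sum>c<d. x c * y c)"

definition norm_d :: "nat \<Rightarrow> rvec \<Rightarrow> real"
  where "norm_d d x = L2_set x {..<d}"

lemma norm_d_eq: "norm_d d x = sqrt (inner_d d x x)"
  by (simp add: norm_d_def inner_d_def L2_set_def power2_eq_square)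


text \<open>
  Clients are indexed by \<open>{1..n}\<close>, the components of client \<open>i\<close> by \<open>{1..m i}\<close>;
  \<open>F i j\<close> is the operator \<open>F\<^sub>i\<^sub>,\<^sub>j\<close>.
\<close>

definition client_op :: "(nat \<Rightarrow> nat) \<Rightarrow> (nat \<Rightarrow> nat \<Rightarrow> rvec \<Rightarrow> rvec) \<Rightarrow> nat \<Rightarrow> rvec \<Rightarrow> rvec"
  where "client_op m F i z = (1 / real (m i)) *\<^sub>R (\<Sum>j = 1..m i. F i j z)"

definition mean_op :: "nat \<Rightarrow> (nat \<Rightarrow> nat) \<Rightarrow> (nat \<Rightarrow> nat \<Rightarrow> rvec \<Rightarrow> rvec) \<Rightarrow> rvec \<Rightarrow> rvec"
  where "mean_op n m F z = (1 / real n) *\<^sub>R (\<Sum>i = 1..n. client_op m F i z)"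

definition vi_solution :: "nat \<Rightarrow> (rvec \<Rightarrow> rvec) \<Rightarrow> rvec \<Rightarrow> bool"
  where "vi_solution d G zs \<longleftrightarrow>
    zs \<in> R_space d \<and> (\<forall>z\<in>R_space d. inner_d d (G zs) (z - zs) \<ge> 0)"

definition quasi_strongly_monotone :: "nat \<Rightarrow> real \<Rightarrow> (rvec \<Rightarrow> rvec) \<Rightarrow> rvec \<Rightarrow> bool"
  where "quasi_strongly_monotone d \<mu> G zs \<longleftrightarrow>
    (\<forall>y\<in>R_space d. inner_d d (G y - G zs) (y - zs) \<ge> \<mu> * (norm_d d (y - zs))\<^sup>2)"


text \<open>
  \<open>xs\<close>, \<open>hs\<close>, \<open>ws\<close> are the families \<open>x\<^sub>i\<^sub>,\<^sub>k\<close>, \<open>h\<^sub>i\<^sub>,\<^sub>k\<close>, \<open>w\<^sub>i\<^sub>,\<^sub>k\<close>;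
  \<open>rounds\<close> counts the communication rounds performed so far.
\<close>

record fl_state =
  xs :: "nat \<Rightarrow> rvec"
  hs :: "nat \<Rightarrow> rvec"
  ws :: "nat \<Rightarrow> rvec"
  rounds :: nat

definition fl_init :: "(nat \<Rightarrow> rvec) \<Rightarrow> fl_state"
  where "fl_init x0 = \<lparr>xs = x0, hs = (\<lambda>i. 0), ws = x0, rounds = 0\<rparr>"

text \<open>
  One iteration for given coins \<open>\<theta>\<close>, \<open>\<zeta>\<close> and given indices \<open>j i\<close> drawn by the clients.
\<close>

definition fl_step ::
  "nat \<Rightarrow> (nat \<Rightarrow> nat) \<Rightarrow> (nat \<Rightarrow> nat \<Rightarrow> rvec \<Rightarrow> rvec) \<Rightarrow> real \<Rightarrow> real \<Rightarrow>
   bool \<Rightarrow> bool \<Rightarrow> (nat \<Rightarrow> nat) \<Rightarrow> fl_state \<Rightarrow> fl_state"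
  where "fl_step n m F \<gamma> p \<theta> \<zeta> j s =
    (let g = (\<lambda>i. F i (j i) (xs s i) - F i (j i) (ws s i) + client_op m F i (ws s i));
         x_hat = (\<lambda>i. xs s i - \<gamma> *\<^sub>R (g i - hs s i));
         x_avg = (1 / real n) *\<^sub>R (\<Sum>l = 1..n. x_hat l - (\<gamma> / p) *\<^sub>R hs s l);
         x_new = (\<lambda>i. if \<theta> then x_avg else x_hat i)
     in \<lparr>xs = x_new,
         hs = (\<lambda>i. hs s i + (p / \<gamma>) *\<^sub>R (x_new i - x_hat i)),
         ws = (\<lambda>i. if \<zeta> then xs s i else ws s i),
         rounds = rounds s + (if \<theta> then 1 else 0)\<rparr>)"

text \<open>
  The law of the \<open>k\<close>-th state. The coins and the clients' indices of an iteration are mutually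
  independent and independent of the past; each law has finite support, so every real
  function of the state is integrable. The value \<open>0\<close> passed to \<open>Pi_pmf\<close> is the index at
  non-clients, which is never used.
\<close>

primrec prox_skip_l_svrgda_fl ::
  "nat \<Rightarrow> (nat \<Rightarrow> nat) \<Rightarrow> (nat \<Rightarrow> nat \<Rightarrow> rvec \<Rightarrow> rvec) \<Rightarrow> real \<Rightarrow> real \<Rightarrow> real \<Rightarrow>
   (nat \<Rightarrow> rvec) \<Rightarrow> nat \<Rightarrow> fl_state pmf"
  where
    "prox_skip_l_svrgda_fl n m F \<gamma> p q x0 0 = return_pmf (fl_init x0)"
  | "prox_skip_l_svrgda_fl n m F \<gamma> p q x0 (Suc k) =
      bind_pmf (prox_skip_l_svrgda_fl n m F \<gamma> p q x0 k) (\<lambda>s.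
      bind_pmf (bernoulli_pmf p) (\<lambda>\<theta>.
      bind_pmf (bernoulli_pmf q) (\<lambda>\<zeta>.
      bind_pmf (Pi_pmf {1..n} 0 (\<lambda>i. pmf_of_set {1..m i})) (\<lambda>j.
      return_pmf (fl_step n m F \<gamma> p \<theta> \<zeta> j s)))))"

definition sigma_sq ::
  "nat \<Rightarrow> nat \<Rightarrow> (nat \<Rightarrow> nat) \<Rightarrow> (nat \<Rightarrow> nat \<Rightarrow> rvec \<Rightarrow> rvec) \<Rightarrow> rvec \<Rightarrow> fl_state \<Rightarrow> real"
  where "sigma_sq d n m F zs s =
    (\<Sum>i = 1..n. 1 / real (m i) * (\<Sum>j = 1..m i. (norm_d d (F i j (ws s i) - F i j zs))\<^sup>2))"

definition lyapunov ::
  "nat \<Rightarrow> nat \<Rightarrow> (nat \<Rightarrow> nat) \<Rightarrow> (nat \<Rightarrow> nat \<Rightarrow> rvec \<Rightarrow> rvec) \<Rightarrow> rvec \<Rightarrow> real \<Rightarrow> real \<Rightarrow> real \<Rightarrow>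
   fl_state \<Rightarrow> real"
  where "lyapunov d n m F zs \<gamma> p M s =
    (\<Sum>i = 1..n. (norm_d d (xs s i - zs))\<^sup>2)
    + \<gamma>\<^sup>2 / p\<^sup>2 * (\<Sum>i = 1..n. (norm_d d (hs s i - client_op m F i zs))\<^sup>2)
    + M * \<gamma>\<^sup>2 * sigma_sq d n m F zs s"

end

theory Submission
  imports Defs
begin

text \<open>
  One iteration contracts the Lyapunov function in expectation, and the contraction comes from
  three separate effects.

  The communication coin. Put \<open>v\<^sub>i = x_hat\<^sub>i - (\<gamma>/p) h\<^sub>i\<close>. On communication \<open>x\<^sub>i\<close> becomes the mean of
  the \<open>v\<^sub>l\<close> and \<open>(\<gamma>/p) h\<^sub>i\<close> becomes the mean minus \<open>v\<^sub>i\<close>: the two parts of the orthogonal decomposition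
  of \<open>v\<close> along the consensus subspace. The point
  \<open>zs - (\<gamma>/p) H\<^sub>i zs\<close> decomposes in the same way into \<open>zs\<close> and \<open>(\<gamma>/p) H\<^sub>i zs\<close>, because a solution of
  the unconstrained variational inequality has \<open>\<Sum>\<^sub>i H\<^sub>i zs = 0\<close>. So Pythagoras expresses the new
  distances through \<open>v\<close> exactly, and averaging over the coin leaves
  \<open>\<parallel>x\<^sub>i - zs - \<gamma> (g\<^sub>i - H\<^sub>i zs)\<parallel>\<^sup>2\<close> and the old control-variate term multiplied by \<open>1 - p\<^sup>2\<close>
  (\<open>coin_average\<close>).

  The stochastic step. The estimator \<open>g\<^sub>i\<close> is unbiased, and its second moment around \<open>H\<^sub>i zs\<close> is at
  most twice the spread of the components at \<open>x\<^sub>i\<close> plus twice the spread at \<open>w\<^sub>i\<close>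
  (\<open>client_step_bound\<close>). The first is controlled by the assumed co-coercivity, the second is
  the quantity \<open>\<sigma>\<^sup>2\<close> in the Lyapunov function.

  The reference point. The refresh coin replaces a fraction \<open>q\<close> of \<open>\<sigma>\<^sup>2\<close> by the spread at
  \<open>x\<^sub>i\<close>. With \<open>M = 4/q\<close> half of this decrease pays for the noise \<open>2 \<gamma>\<^sup>2 \<sigma>\<^sup>2\<close>. All spread terms at
  \<open>x\<^sub>i\<close> then add up to at most \<open>6 \<gamma>\<^sup>2 L\<close> times \<open>\<langle>H\<^sub>i x\<^sub>i - H\<^sub>i zs, x\<^sub>i - zs\<rangle>\<close>, which for \<open>\<gamma> \<le> 1/(6L)\<close> is at most half of the
  progress \<open>2\<gamma>\<langle>H\<^sub>i x\<^sub>i - H\<^sub>i zs, x\<^sub>i - zs\<rangle>\<close> of the step; quasi-strong monotonicity turns the other half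
  into a decrease of \<open>\<parallel>x\<^sub>i - zs\<parallel>\<^sup>2\<close>.

  Hence the Lyapunov function contracts by \<open>1 - min (\<gamma> \<mu>) (min (p\<^sup>2) (q/2))\<close>
  (\<open>lyapunov_contraction\<close>). Balancing the three rates at \<open>c = \<mu>/(6L)\<close> gives \<open>p = sqrt c\<close> and
  \<open>q = 2c\<close>, which are probabilities since \<open>\<mu> \<le> L\<close> (\<open>mu_le_L\<close>). About \<open>ln (V\<^sub>0/\<epsilon>) / c\<close> iterations
  suffice, and the expected number of rounds is \<open>sqrt c\<close> times as large.
\<close>


section \<open>Coordinatewise identities\<close>

lemma fun_sum_apply: "(\<Sum>i\<in>I. f i) c = (\<Sum>i\<in>I. f i c)" for f :: "'i \<Rightarrow> 'a \<Rightarrow> real"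
  by (induction I rule: infinite_finite_induct) simp_all

lemma scaleR_fun_apply: "(a *\<^sub>R f) c = a * f c" for f :: "'a \<Rightarrow> real"
  by (simp add: scaleR_fun_def)

lemma norm_d_power2: "(norm_d d x)\<^sup>2 = (\<Sum>c<d. (x c)\<^sup>2)"
  by (simp add: norm_d_def L2_set_def sum_nonneg)

text \<open>
  Pythagoras for the projection of a vector onto the constant vectors.
\<close>

lemma mean_pythagoras:
  fixes u :: "nat \<Rightarrow> real"
  assumes "n \<ge> 1"
  defines "U \<equiv> (\<Sum>i = 1..n. u i) / real n"
  shows "(\<Sum>i = 1..n. U\<^sup>2 + (U - u i)\<^sup>2) = (\<Sum>i = 1..n. (u i)\<^sup>2)"
proof -
  have U: "(\<Sum>i = 1..n. u i) = real n * U"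
    using assms by simp
  have "(\<Sum>i = 1..n. U\<^sup>2 + (U - u i)\<^sup>2) = (\<Sum>i = 1..n. 2 * U\<^sup>2 - 2 * U * u i + (u i)\<^sup>2)"
    by (intro sum.cong) (auto simp: power2_eq_square algebra_simps)
  also have "\<dots> = real n * (2 * U\<^sup>2) - 2 * U * (\<Sum>i = 1..n. u i) + (\<Sum>i = 1..n. (u i)\<^sup>2)"
    by (simp add: sum.distrib sum_subtractf sum_distrib_left)
  finally show ?thesis
    using U by (simp only:) (simp add: power2_eq_square algebra_simps)
qed

text \<open>
  One coordinate of the communication step. With the residuals \<open>u i\<close> of \<open>xh i - (\<gamma>/p) h i\<close> against
  their values at the solution, the two errors after communication are the mean of the \<open>u i\<close>
  and the deviations from it, so they add up to \<open>\<Sum> (u i)\<^sup>2\<close>. Writing \<open>u i = a - b\<close> with \<open>a\<close> the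
  error of \<open>xh i\<close> and \<open>b\<close> the scaled error of \<open>h i\<close>, the claim reduces to
  \<open>p (a - b)\<^sup>2 + (1 - p) (a\<^sup>2 + b\<^sup>2) = (a - p b)\<^sup>2 + (1 - p\<^sup>2) b\<^sup>2\<close>, and \<open>a - p b\<close> no longer contains \<open>h i\<close>.
\<close>

lemma coin_average_coordinate:
  fixes x g h hs :: "nat \<Rightarrow> real" and z \<gamma> p :: real
  assumes n: "n \<ge> 1" and hs: "(\<Sum>i = 1..n. hs i) = 0" and \<gamma>: "\<gamma> > 0" and p: "p > 0"
  defines "xh \<equiv> \<lambda>i. x i - \<gamma> * (g i - h i)"
  defines "X \<equiv> 1 / real n * (\<Sum>i = 1..n. xh i - \<gamma> / p * h i)"
  shows "p * (\<Sum>i = 1..n. (X - z)\<^sup>2 + \<gamma>\<^sup>2 / p\<^sup>2 * (h i + p / \<gamma> * (X - xh i) - hs i)\<^sup>2)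
      + (1 - p) * (\<Sum>i = 1..n. (xh i - z)\<^sup>2 + \<gamma>\<^sup>2 / p\<^sup>2 * (h i - hs i)\<^sup>2)
    = (\<Sum>i = 1..n. (x i - z - \<gamma> * (g i - hs i))\<^sup>2 + (1 - p\<^sup>2) * (\<gamma>\<^sup>2 / p\<^sup>2 * (h i - hs i)\<^sup>2))"
proof -
  define u where "u i = (xh i - \<gamma> / p * h i) - (z - \<gamma> / p * hs i)" for i
  have "(\<Sum>i = 1..n. u i) = (\<Sum>i = 1..n. xh i - \<gamma> / p * h i) - real n * z + \<gamma> / p * (\<Sum>i = 1..n. hs i)"
    unfolding u_def by (simp add: sum.distrib sum_subtractf sum_distrib_left)
  then have X: "X - z = (\<Sum>i = 1..n. u i) / real n"
    unfolding X_def hs using n by (simp add: diff_divide_distrib)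
  have sq: "\<gamma>\<^sup>2 / p\<^sup>2 * (h i + p / \<gamma> * (X - xh i) - hs i)\<^sup>2 = ((X - z) - u i)\<^sup>2" for i
  proof -
    have "(X - z) - u i = \<gamma> / p * (h i + p / \<gamma> * (X - xh i) - hs i)"
      using \<gamma> p by (simp add: u_def field_simps)
    then show ?thesis
      by (simp add: power_mult_distrib power_divide)
  qed
  have comm: "(\<Sum>i = 1..n. (X - z)\<^sup>2 + \<gamma>\<^sup>2 / p\<^sup>2 * (h i + p / \<gamma> * (X - xh i) - hs i)\<^sup>2)
      = (\<Sum>i = 1..n. (u i)\<^sup>2)"
    unfolding sq X by (rule mean_pythagoras[OF n])
  have pt: "p * (u i)\<^sup>2 + (1 - p) * ((xh i - z)\<^sup>2 + \<gamma>\<^sup>2 / p\<^sup>2 * (h i - hs i)\<^sup>2)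
    = (x i - z - \<gamma> * (g i - hs i))\<^sup>2 + (1 - p\<^sup>2) * (\<gamma>\<^sup>2 / p\<^sup>2 * (h i - hs i)\<^sup>2)" for i
  proof -
    define a b where "a = xh i - z" and "b = \<gamma> / p * (h i - hs i)"
    have 1: "u i = a - b" "x i - z - \<gamma> * (g i - hs i) = a - p * b"
      using p by (simp_all add: u_def a_def b_def xh_def algebra_simps)
    have 2: "\<gamma>\<^sup>2 / p\<^sup>2 * (h i - hs i)\<^sup>2 = b\<^sup>2"
      by (simp add: b_def power_mult_distrib power_divide)
    show ?thesis
      unfolding 1 2 a_def[symmetric] by (simp add: power2_eq_square algebra_simps)
  qed
  show ?thesis
    unfolding comm pt[symmetric] by (simp only: sum_distrib_left sum.distrib[symmetric])
qed

text \<open>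
  The correction \<open>B - b j\<close> has mean zero, so its cross term with \<open>u\<close> averages out, and its
  variance is at most the second moment of \<open>b\<close>. The factors 2 are the price of separating it from
  \<open>a j\<close>, with which it may be correlated.
\<close>

lemma variance_reduced_step_coordinate:
  fixes a b :: "nat \<Rightarrow> real" and u \<gamma> :: real
  assumes m: "m \<ge> 1"
  defines "A \<equiv> 1 / real m * (\<Sum>j = 1..m. a j)" and "B \<equiv> 1 / real m * (\<Sum>j = 1..m. b j)"
  shows "1 / real m * (\<Sum>j = 1..m. (u - \<gamma> * (a j - b j + B))\<^sup>2)
    \<le> u\<^sup>2 - 2 * \<gamma> * (A * u) + \<gamma>\<^sup>2 * (2 * (1 / real m * (\<Sum>j = 1..m. (a j)\<^sup>2))
                                    + 2 * (1 / real m * (\<Sum>j = 1..m. (b j)\<^sup>2)))"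
proof -
  have sums: "(\<Sum>j = 1..m. a j) = real m * A" "(\<Sum>j = 1..m. b j) = real m * B"
    using m by (simp_all add: A_def B_def)
  have "(u - \<gamma> * (a j - b j + B))\<^sup>2 \<le> u\<^sup>2 - 2 * \<gamma> * u * a j + 2 * \<gamma> * u * (b j - B)
      + \<gamma>\<^sup>2 * (2 * (a j)\<^sup>2 + 2 * (b j - B)\<^sup>2)" for j
  proof -
    have "(a j - (b j - B))\<^sup>2 \<le> 2 * (a j)\<^sup>2 + 2 * (b j - B)\<^sup>2"
      using zero_le_power2[of "a j + (b j - B)"] by (simp add: power2_eq_square algebra_simps)
    from mult_left_mono[OF this, of "\<gamma>\<^sup>2"] show ?thesis
      by (simp add: power2_eq_square algebra_simps)
  qed
  then have "(\<Sum>j = 1..m. (u - \<gamma> * (a j - b j + B))\<^sup>2)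
    \<le> (\<Sum>j = 1..m. u\<^sup>2 - 2 * \<gamma> * u * a j + 2 * \<gamma> * u * (b j - B)
      + \<gamma>\<^sup>2 * (2 * (a j)\<^sup>2 + 2 * (b j - B)\<^sup>2))"
    by (intro sum_mono)
  also have "\<dots> = (\<Sum>j = 1..m. (u\<^sup>2 - 2 * \<gamma> * u * B + 2 * \<gamma>\<^sup>2 * B\<^sup>2) - (2 * \<gamma> * u) * a j
      + (2 * \<gamma> * u - 4 * \<gamma>\<^sup>2 * B) * b j + 2 * \<gamma>\<^sup>2 * (a j)\<^sup>2 + 2 * \<gamma>\<^sup>2 * (b j)\<^sup>2)"
    by (intro sum.cong refl) (simp add: power2_eq_square algebra_simps)
  also have "\<dots> = real m * (u\<^sup>2 - 2 * \<gamma> * u * B + 2 * \<gamma>\<^sup>2 * B\<^sup>2) - (2 * \<gamma> * u) * (\<Sum>j = 1..m. a j)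
      + (2 * \<gamma> * u - 4 * \<gamma>\<^sup>2 * B) * (\<Sum>j = 1..m. b j)
      + 2 * \<gamma>\<^sup>2 * (\<Sum>j = 1..m. (a j)\<^sup>2) + 2 * \<gamma>\<^sup>2 * (\<Sum>j = 1..m. (b j)\<^sup>2)"
    by (simp only: sum.distrib sum_subtractf sum_distrib_left[symmetric] sum_constant) (simp add: algebra_simps)
  also have "\<dots> = real m * (u\<^sup>2 - 2 * \<gamma> * (A * u) - 2 * \<gamma>\<^sup>2 * B\<^sup>2)
      + 2 * \<gamma>\<^sup>2 * (\<Sum>j = 1..m. (a j)\<^sup>2) + 2 * \<gamma>\<^sup>2 * (\<Sum>j = 1..m. (b j)\<^sup>2)"
    unfolding sums by (simp add: power2_eq_square algebra_simps)
  also have "\<dots> \<le> real m * (u\<^sup>2 - 2 * \<gamma> * (A * u))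
      + 2 * \<gamma>\<^sup>2 * (\<Sum>j = 1..m. (a j)\<^sup>2) + 2 * \<gamma>\<^sup>2 * (\<Sum>j = 1..m. (b j)\<^sup>2)"
    by (simp add: algebra_simps)
  finally show ?thesis
    using m by (simp add: field_simps)
qed


section \<open>Expectations and iteration counts\<close>

lemma expectation_bind_finite:
  fixes h :: "'b \<Rightarrow> real"
  assumes "finite (set_pmf P)" and "\<And>x. x \<in> set_pmf P \<Longrightarrow> finite (set_pmf (f x))"
  shows "measure_pmf.expectation (bind_pmf P f) h
       = measure_pmf.expectation P (\<lambda>x. measure_pmf.expectation (f x) h)"
  using assms
  by (subst pmf_expectation_bind[where A = "set_pmf P"])
     (auto intro!: integral_measure_pmf[symmetric] simp: integral_measure_pmf)

text \<open>
  Take \<open>K\<close> to be \<open>ln (V/\<epsilon>) / c\<close> rounded up. The factor 2 in the logarithm absorbs the rounding: when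
  \<open>V > \<epsilon>\<close>, the logarithm is at least \<open>ln 2\<close>, so the additional \<open>c \<le> 1\<close> costs at most a
  constant multiple of it.
\<close>

lemma contraction_iterations:
  fixes c V \<epsilon> :: real
  assumes c: "0 < c" "c \<le> 1" and V: "V \<ge> 0" and \<epsilon>: "\<epsilon> > 0"
  shows "\<exists>K::nat. (1 - c) ^ K * V \<le> \<epsilon> \<and> c * real K \<le> 3 * max 0 (ln (2 * V / \<epsilon>))"
proof (cases "V \<le> \<epsilon>")
  case True
  then show ?thesis
    by (intro exI[of _ 0]) auto
next
  case False
  define l where "l = ln (V / \<epsilon>)"
  define K where "K = nat \<lceil>l / c\<rceil>"
  have l: "l > 0"
    using False \<epsilon> by (simp add: l_def)
  have ln2: "ln (2 * V / \<epsilon>) = ln 2 + l"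
    using False \<epsilon> unfolding l_def by (subst ln_mult_pos[symmetric]) auto
  have lower: "l \<le> c * real K"
    using c l unfolding K_def by (simp add: field_simps) (smt (verit) divide_pos_pos mult.commute pos_divide_le_eq le_of_int_ceiling of_nat_0_le_iff)
  have upper: "c * real K \<le> l + c"
  proof -
    have "real K \<le> l / c + 1"
      using c l unfolding K_def by (simp add: of_nat_nat less_imp_le)
    then show ?thesis
      using c by (simp add: field_simps)
  qed
  have "(1 - c) ^ K \<le> exp (- c) ^ K"
    using c exp_ge_add_one_self[of "- c"] by (intro power_mono) auto
  also have "\<dots> = exp (- (c * real K))"
    by (simp add: exp_of_nat_mult[symmetric] mult.commute)
  also have "\<dots> \<le> exp (- l)"
    using lower by simp
  also have "\<dots> = \<epsilon> / V"
    using False \<epsilon> by (simp add: l_def exp_minus)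
  finally have "(1 - c) ^ K * V \<le> \<epsilon>"
    using False \<epsilon> by (simp add: field_simps)
  moreover have "c * real K \<le> 3 * max 0 (ln (2 * V / \<epsilon>))"
    using upper c l ln2_ge_two_thirds by (simp add: ln2)
  ultimately show ?thesis
    by blast
qed


section \<open>The algorithm around a solution\<close>

definition fl_kernel ::
  "nat \<Rightarrow> (nat \<Rightarrow> nat) \<Rightarrow> (nat \<Rightarrow> nat \<Rightarrow> rvec \<Rightarrow> rvec) \<Rightarrow> real \<Rightarrow> real \<Rightarrow> real \<Rightarrow>
   fl_state \<Rightarrow> fl_state pmf"
  where "fl_kernel n m F \<gamma> p q s =
    bind_pmf (bernoulli_pmf p) (\<lambda>\<theta>.
    bind_pmf (bernoulli_pmf q) (\<lambda>\<zeta>.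
    bind_pmf (Pi_pmf {1..n} 0 (\<lambda>i. pmf_of_set {1..m i})) (\<lambda>j.
    return_pmf (fl_step n m F \<gamma> p \<theta> \<zeta> j s))))"

lemma prox_skip_Suc:
  "prox_skip_l_svrgda_fl n m F \<gamma> p q x0 (Suc k)
   = bind_pmf (prox_skip_l_svrgda_fl n m F \<gamma> p q x0 k) (fl_kernel n m F \<gamma> p q)"
  by (simp add: fl_kernel_def[abs_def])

definition in_space :: "nat \<Rightarrow> nat \<Rightarrow> fl_state \<Rightarrow> bool"
  where "in_space d n s \<longleftrightarrow>
    (\<forall>i\<in>{1..n}. xs s i \<in> R_space d \<and> hs s i \<in> R_space d \<and> ws s i \<in> R_space d)"

lemma R_space_iff: "x \<in> R_space d \<longleftrightarrow> (\<forall>c\<ge>d. x c = 0)"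
  by (simp add: topspace_Euclidean_space)

locale federated_vi =
  fixes d n :: nat and m :: "nat \<Rightarrow> nat" and F :: "nat \<Rightarrow> nat \<Rightarrow> rvec \<Rightarrow> rvec"
    and zs :: rvec and \<mu> L :: real
  assumes d: "d \<ge> 1" and n: "n \<ge> 1" and m: "i \<in> {1..n} \<Longrightarrow> m i \<ge> 1"
    and F_maps: "i \<in> {1..n} \<Longrightarrow> j \<in> {1..m i} \<Longrightarrow> y \<in> R_space d \<Longrightarrow> F i j y \<in> R_space d"
    and solution: "vi_solution d (mean_op n m F) zs"
    and mu: "\<mu> > 0"
    and monotone: "i \<in> {1..n} \<Longrightarrow> quasi_strongly_monotone d \<mu> (client_op m F i) zs"
    and cocoercive: "i \<in> {1..n} \<Longrightarrow> y \<in> R_space d \<Longrightarrow>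
        1 / real (m i) * (\<Sum>j = 1..m i. (norm_d d (F i j y - F i j zs))\<^sup>2)
          \<le> L * inner_d d (client_op m F i y - client_op m F i zs) (y - zs)"
begin

abbreviation H :: "nat \<Rightarrow> rvec \<Rightarrow> rvec"
  where "H \<equiv> client_op m F"

definition progress :: "nat \<Rightarrow> rvec \<Rightarrow> real"
  where "progress i y = inner_d d (H i y - H i zs) (y - zs)"

definition spread :: "nat \<Rightarrow> rvec \<Rightarrow> real"
  where "spread i y = 1 / real (m i) * (\<Sum>j = 1..m i. (norm_d d (F i j y - F i j zs))\<^sup>2)"

lemma client_op_coordinate: "H i y c = 1 / real (m i) * (\<Sum>j = 1..m i. F i j y c)"
  by (simp add: client_op_def scaleR_fun_apply fun_sum_apply)

lemma client_op_diff_coordinate: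
  "H i y c - H i z c = 1 / real (m i) * (\<Sum>j = 1..m i. F i j y c - F i j z c)"
  by (simp add: client_op_coordinate sum_subtractf right_diff_distrib)

lemma spread_le: "i \<in> {1..n} \<Longrightarrow> y \<in> R_space d \<Longrightarrow> spread i y \<le> L * progress i y"
  using cocoercive by (simp add: spread_def progress_def)

lemma progress_ge:
  "i \<in> {1..n} \<Longrightarrow> y \<in> R_space d \<Longrightarrow> \<mu> * (norm_d d (y - zs))\<^sup>2 \<le> progress i y"
  using monotone by (simp add: quasi_strongly_monotone_def progress_def)

lemma spread_nonneg: "spread i y \<ge> 0"
  by (simp add: spread_def sum_nonneg)

lemma spread_coordinates:
  "spread i y = (\<Sum>c<d. 1 / real (m i) * (\<Sum>j = 1..m i. (F i j y c - F i j zs c)\<^sup>2))"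
  unfolding spread_def norm_d_power2 minus_apply by (subst sum.swap) (simp add: sum_distrib_left)

lemma zs_in_space: "zs \<in> R_space d"
  using solution by (simp add: vi_solution_def)

lemma client_op_in_space: "i \<in> {1..n} \<Longrightarrow> y \<in> R_space d \<Longrightarrow> H i y \<in> R_space d"
  using F_maps unfolding R_space_iff client_op_coordinate by (auto intro!: sum.neutral)

text \<open>
  Testing the variational inequality at \<open>zs - G zs\<close>, where \<open>G\<close> is the mean operator, yields \<open>- \<parallel>G zs\<parallel>\<^sup>2 \<ge> 0\<close>.
\<close>

lemma sum_client_op_solution:
  assumes "c < d"
  shows "(\<Sum>i = 1..n. H i zs c) = 0"
proof -
  let ?G = "mean_op n m F zs"
  have coord: "?G c = 1 / real n * (\<Sum>i = 1..n. H i zs c)" for c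
    by (simp add: mean_op_def scaleR_fun_apply fun_sum_apply)
  have "?G \<in> R_space d"
    using client_op_in_space[OF _ zs_in_space] unfolding R_space_iff coord by (auto intro!: sum.neutral)
  then have "zs - ?G \<in> R_space d"
    using zs_in_space by (simp add: R_space_iff)
  then have "inner_d d ?G ((zs - ?G) - zs) \<ge> 0"
    using solution unfolding vi_solution_def by blast
  then have "(\<Sum>c<d. (?G c)\<^sup>2) \<le> 0"
    by (simp add: inner_d_def sum_negf power2_eq_square)
  then have "(\<Sum>c<d. (?G c)\<^sup>2) = 0"
    by (intro antisym sum_nonneg) auto
  then have "?G c = 0"
    using assms by (simp add: sum_nonneg_eq_0_iff)
  then show ?thesis
    using n by (simp add: coord)
qed

text \<open>
  Let \<open>D\<close> be the progress at a point at distance 1 from \<open>zs\<close>. Monotonicity gives \<open>\<mu> \<le> D\<close>. Jensen's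
  inequality and co-coercivity give \<open>D\<^sup>2 \<le> \<parallel>H y - H zs\<parallel>\<^sup>2 \<le> L D\<close>, hence \<open>D \<le> L\<close>. Moving along the first
  axis makes \<open>D\<close> a single coordinate, which replaces Cauchy-Schwarz.
\<close>

lemma mu_le_L: "\<mu> \<le> L"
proof -
  define y where "y = zs + (\<lambda>c. if c = 0 then 1 else 0)"
  have one: "1 \<in> {1..n}"
    using n by simp
  have y: "y \<in> R_space d"
    using zs_in_space d by (simp add: y_def R_space_iff)
  have diff: "(y - zs) c = (if c = 0 then 1 else 0)" for c
    by (simp add: y_def)
  have D: "progress 1 y = H 1 y 0 - H 1 zs 0"
    using d unfolding progress_def inner_d_def diff by (simp add: if_distrib[of "\<lambda>t. _ * t"] cong: if_cong)
  have "(norm_d d (y - zs))\<^sup>2 = 1"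
    using d unfolding norm_d_power2 diff by (simp add: if_distrib[of "\<lambda>t. t\<^sup>2"] cong: if_cong)
  with progress_ge[OF one y] have mu_D: "\<mu> \<le> progress 1 y"
    by simp
  have "(progress 1 y)\<^sup>2 \<le> 1 / real (m 1) * (\<Sum>j = 1..m 1. (F 1 j y 0 - F 1 j zs 0)\<^sup>2)"
  proof -
    have "(\<Sum>j = 1..m 1. F 1 j y 0 - F 1 j zs 0)\<^sup>2
        \<le> (\<Sum>j = 1..m 1. (F 1 j y 0 - F 1 j zs 0)\<^sup>2) * real (m 1)"
      using sum_squared_le_sum_of_squares[of "\<lambda>j. F 1 j y 0 - F 1 j zs 0" "{1..m 1}"] by simp
    then show ?thesis
      using m[OF one] unfolding D client_op_diff_coordinate
      by (simp add: power_mult_distrib power_divide field_simps power2_eq_square)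
  qed
  also have "\<dots> \<le> spread 1 y"
    unfolding spread_coordinates using d
    by (intro member_le_sum[where i = 0 and f = "\<lambda>c. 1 / real (m 1) * (\<Sum>j = 1..m 1. (F 1 j y c - F 1 j zs c)\<^sup>2)"])
       (auto intro!: sum_nonneg divide_nonneg_nonneg)
  also have "\<dots> \<le> L * progress 1 y"
    by (rule spread_le[OF one y])
  finally have "progress 1 y \<le> L"
    using mu_D mu by (simp add: power2_eq_square)
  with mu_D show ?thesis
    by simp
qed

lemma client_step_bound:
  assumes i: "i \<in> {1..n}"
  shows "1 / real (m i) * (\<Sum>j = 1..m i.
      (norm_d d (y - zs - \<gamma> *\<^sub>R (F i j y - F i j w + H i w - H i zs)))\<^sup>2)
    \<le> (norm_d d (y - zs))\<^sup>2 - 2 * \<gamma> * progress i y + \<gamma>\<^sup>2 * (2 * spread i y + 2 * spread i w)"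
proof -
  have "1 / real (m i) * (\<Sum>j = 1..m i.
      (norm_d d (y - zs - \<gamma> *\<^sub>R (F i j y - F i j w + H i w - H i zs)))\<^sup>2)
    = (\<Sum>c<d. 1 / real (m i) * (\<Sum>j = 1..m i. ((y c - zs c) - \<gamma> * ((F i j y c - F i j zs c)
        - (F i j w c - F i j zs c) + (H i w c - H i zs c)))\<^sup>2))"
    unfolding norm_d_power2
    by (subst sum.swap) (simp add: sum_distrib_left scaleR_fun_apply algebra_simps)
  also have "\<dots> \<le> (\<Sum>c<d. (y c - zs c)\<^sup>2 - 2 * \<gamma> * ((H i y c - H i zs c) * (y c - zs c))
      + \<gamma>\<^sup>2 * (2 * (1 / real (m i) * (\<Sum>j = 1..m i. (F i j y c - F i j zs c)\<^sup>2))
            + 2 * (1 / real (m i) * (\<Sum>j = 1..m i. (F i j w c - F i j zs c)\<^sup>2))))"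
    unfolding client_op_diff_coordinate
    by (intro sum_mono variance_reduced_step_coordinate m[OF i])
  also have "\<dots> = (norm_d d (y - zs))\<^sup>2 - 2 * \<gamma> * progress i y
      + \<gamma>\<^sup>2 * (2 * spread i y + 2 * spread i w)"
    unfolding norm_d_power2 progress_def inner_d_def spread_coordinates minus_apply
    by (simp only: sum.distrib sum_subtractf sum_distrib_left[symmetric])
  finally show ?thesis .
qed

abbreviation draws :: "(nat \<Rightarrow> nat) pmf"
  where "draws \<equiv> Pi_pmf {1..n} 0 (\<lambda>i. pmf_of_set {1..m i})"

lemma draws_range: "j \<in> set_pmf draws \<Longrightarrow> i \<in> {1..n} \<Longrightarrow> j i \<in> {1..m i}"
  using m[of i] set_pmf_of_set[of "{1..m i}"] by (fastforce simp: set_Pi_pmf PiE_dflt_def)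

lemma finite_draws: "finite (set_pmf draws)"
proof -
  have "finite (set_pmf (pmf_of_set {1..m i}))" if "i \<in> {1..n}" for i
    using m[OF that] by (subst set_pmf_of_set) auto
  then show ?thesis
    by (auto simp: set_Pi_pmf)
qed

lemma draws_integrable: "integrable (measure_pmf draws) f" for f :: "(nat \<Rightarrow> nat) \<Rightarrow> real"
  by (rule integrable_measure_pmf_finite[OF finite_draws])

text \<open>
  Only the marginal law of each client's index enters the expected Lyapunov function: after
  averaging over the coins it is a sum over clients.
\<close>

lemma draws_expectation:
  fixes f :: "nat \<Rightarrow> real"
  assumes i: "i \<in> {1..n}"
  shows "measure_pmf.expectation draws (\<lambda>j. f (j i)) = 1 / real (m i) * (\<Sum>j = 1..m i. f j)"
proof -
  have "measure_pmf.expectation draws (\<lambda>j. f (j i))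
      = measure_pmf.expectation (map_pmf (\<lambda>j. j i) draws) f"
    by simp
  also have "map_pmf (\<lambda>j. j i) draws = pmf_of_set {1..m i}"
    using i by (simp add: Pi_pmf_component)
  finally show ?thesis
    using m[OF i] by (simp add: integral_pmf_of_set)
qed

lemma finite_kernel: "finite (set_pmf (fl_kernel n m F \<gamma> p q s))"
  using finite_draws by (simp add: fl_kernel_def)

lemma kernel_expectation:
  fixes h :: "fl_state \<Rightarrow> real" and \<gamma> p q :: real and s :: fl_state
  assumes "0 < p" "p \<le> 1" "0 < q" "q \<le> 1"
  defines "st \<equiv> \<lambda>\<theta> \<zeta> j. h (fl_step n m F \<gamma> p \<theta> \<zeta> j s)"
  shows "measure_pmf.expectation (fl_kernel n m F \<gamma> p q s) h
    = measure_pmf.expectation draws (\<lambda>j.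
        p * (q * st True True j + (1 - q) * st True False j)
        + (1 - p) * (q * st False True j + (1 - q) * st False False j))"
proof -
  define E where "E \<theta> \<zeta> = measure_pmf.expectation draws (st \<theta> \<zeta>)" for \<theta> \<zeta>
  have "measure_pmf.expectation (bind_pmf draws (\<lambda>j. return_pmf (fl_step n m F \<gamma> p \<theta> \<zeta> j s))) h
      = E \<theta> \<zeta>" for \<theta> \<zeta>
    by (simp add: expectation_bind_finite finite_draws E_def st_def del: One_nat_def)
  then have "measure_pmf.expectation (fl_kernel n m F \<gamma> p q s) h
      = p * (q * E True True + (1 - q) * E True False)
        + (1 - p) * (q * E False True + (1 - q) * E False False)"
    using assms(1-4) unfolding fl_kernel_def
    by (simp add: expectation_bind_finite finite_draws algebra_simps del: One_nat_def)
  then show ?thesis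
    by (simp add: E_def draws_integrable del: One_nat_def)
qed



section \<open>Contraction of the Lyapunov function\<close>

text \<open>
  The drawn indices are held fixed here. The new state on communication couples all clients
  through the mean, but the coin average is a sum of terms that each depend on one client.
\<close>

lemma coin_average:
  fixes \<gamma> p q M :: real and s :: fl_state and j :: "nat \<Rightarrow> nat"
  assumes \<gamma>: "\<gamma> > 0" and p: "p > 0"
  defines "V \<equiv> \<lambda>\<theta> \<zeta>. lyapunov d n m F zs \<gamma> p M (fl_step n m F \<gamma> p \<theta> \<zeta> j s)"
  shows "p * (q * V True True + (1 - q) * V True False)
       + (1 - p) * (q * V False True + (1 - q) * V False False)
    = (\<Sum>i = 1..n. (norm_d d (xs s i - zs - \<gamma> *\<^sub>R
          (F i (j i) (xs s i) - F i (j i) (ws s i) + H i (ws s i) - H i zs)))\<^sup>2)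
      + (1 - p\<^sup>2) * (\<gamma>\<^sup>2 / p\<^sup>2 * (\<Sum>i = 1..n. (norm_d d (hs s i - H i zs))\<^sup>2))
      + M * \<gamma>\<^sup>2 * (q * (\<Sum>i = 1..n. spread i (xs s i)) + (1 - q) * (\<Sum>i = 1..n. spread i (ws s i)))"
proof -
  define g where "g c i = F i (j i) (xs s i) c - F i (j i) (ws s i) c + H i (ws s i) c" for c i
  define xh where "xh c i = xs s i c - \<gamma> * (g c i - hs s i c)" for c i
  define X where "X c = 1 / real n * (\<Sum>i = 1..n. xh c i - \<gamma> / p * hs s i c)" for c
  define T where "T c = (\<Sum>i = 1..n. (X c - zs c)\<^sup>2
      + \<gamma>\<^sup>2 / p\<^sup>2 * (hs s i c + p / \<gamma> * (X c - xh c i) - H i zs c)\<^sup>2)" for c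
  define N where "N c = (\<Sum>i = 1..n. (xh c i - zs c)\<^sup>2 + \<gamma>\<^sup>2 / p\<^sup>2 * (hs s i c - H i zs c)\<^sup>2)" for c
  define S where "S \<zeta> = (\<Sum>i = 1..n. spread i (if \<zeta> then xs s i else ws s i))" for \<zeta>
  (* The Lyapunov function is regrouped by coordinates: communication mixes clients, not coordinates. *)
  have coords: "(\<Sum>i = 1..n. \<Sum>c<d. a c i) + k * (\<Sum>i = 1..n. \<Sum>c<d. b c i)
      = (\<Sum>c<d. \<Sum>i = 1..n. a c i + k * b c i)" for a b :: "nat \<Rightarrow> nat \<Rightarrow> real" and k :: real
    by (simp only: sum.swap[where A = "{1..n}"] sum.distrib sum_distrib_left)
  have V: "V \<theta> \<zeta> = (\<Sum>c<d. if \<theta> then T c else N c) + M * \<gamma>\<^sup>2 * S \<zeta>" for \<theta> \<zeta>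
    unfolding V_def lyapunov_def norm_d_power2 coords
    by (cases \<theta>) (simp_all add: fl_step_def Let_def sigma_sq_def spread_def S_def T_def N_def X_def
        xh_def g_def scaleR_fun_apply fun_sum_apply norm_d_power2)
  have coord: "p * T c + (1 - p) * N c
      = (\<Sum>i = 1..n. (xs s i c - zs c - \<gamma> * (g c i - H i zs c))\<^sup>2
          + (1 - p\<^sup>2) * (\<gamma>\<^sup>2 / p\<^sup>2 * (hs s i c - H i zs c)\<^sup>2))" if "c < d" for c
    unfolding T_def N_def X_def xh_def
    by (rule coin_average_coordinate[OF n sum_client_op_solution[OF that] \<gamma> p])
  have "p * (q * V True True + (1 - q) * V True False)
       + (1 - p) * (q * V False True + (1 - q) * V False False)
     = (\<Sum>c<d. p * T c + (1 - p) * N c) + M * \<gamma>\<^sup>2 * (q * S True + (1 - q) * S False)"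
  proof -
    have "(\<Sum>c<d. p * T c + (1 - p) * N c) = p * (\<Sum>c<d. T c) + (1 - p) * (\<Sum>c<d. N c)"
      by (simp only: sum.distrib sum_distrib_left)
    then show ?thesis
      unfolding V by (simp add: algebra_simps)
  qed
  also have "(\<Sum>c<d. p * T c + (1 - p) * N c)
     = (\<Sum>c<d. \<Sum>i = 1..n. (xs s i c - zs c - \<gamma> * (g c i - H i zs c))\<^sup>2
          + ((1 - p\<^sup>2) * (\<gamma>\<^sup>2 / p\<^sup>2)) * (hs s i c - H i zs c)\<^sup>2)"
    using coord by (intro sum.cong) (simp_all add: mult.assoc)
  also have "\<dots> = (\<Sum>i = 1..n. \<Sum>c<d. (xs s i c - zs c - \<gamma> * (g c i - H i zs c))\<^sup>2)
      + ((1 - p\<^sup>2) * (\<gamma>\<^sup>2 / p\<^sup>2)) * (\<Sum>i = 1..n. \<Sum>c<d. (hs s i c - H i zs c)\<^sup>2)"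
    by (rule coords[symmetric])
  finally show ?thesis
    by (simp add: norm_d_power2 g_def S_def scaleR_fun_apply mult.assoc)
qed

text \<open>
  The weight \<open>4/q\<close> makes \<open>2 \<gamma>\<^sup>2\<close>, the coefficient of the noise from the reference points, exactly
  a fraction \<open>q/2\<close> of the coefficient of \<open>\<sigma>\<^sup>2\<close>. The number 6 is the cost of the spread at the
  current points: 2 from the estimator and 4 from refreshing the reference points.
\<close>

lemma lyapunov_contraction:
  fixes \<gamma> p q c :: real
  assumes s: "in_space d n s"
    and \<gamma>: "\<gamma> > 0" "6 * \<gamma> * L \<le> 1" and p: "0 < p" "p \<le> 1" and q: "0 < q" "q \<le> 1"
    and c: "c \<le> \<gamma> * \<mu>" "c \<le> p\<^sup>2" "c \<le> q / 2"
  defines "V \<equiv> lyapunov d n m F zs \<gamma> p (4 / q)"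
  shows "measure_pmf.expectation (fl_kernel n m F \<gamma> p q s) V \<le> (1 - c) * V s"
proof -
  define R where "R i j = (norm_d d (xs s i - zs - \<gamma> *\<^sub>R
      (F i j (xs s i) - F i j (ws s i) + H i (ws s i) - H i zs)))\<^sup>2" for i j
  define N where "N = (\<Sum>i = 1..n. (norm_d d (xs s i - zs))\<^sup>2)"
  define E where "E = \<gamma>\<^sup>2 / p\<^sup>2 * (\<Sum>i = 1..n. (norm_d d (hs s i - H i zs))\<^sup>2)"
  define D where "D = (\<Sum>i = 1..n. progress i (xs s i))"
  define S where "S = (\<Sum>i = 1..n. spread i (xs s i))"
  define W where "W = (\<Sum>i = 1..n. spread i (ws s i))"
  define U where "U = 4 / q * \<gamma>\<^sup>2 * W"
  have V: "V s = N + E + U"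
    by (simp add: U_def V_def lyapunov_def N_def E_def W_def sigma_sq_def spread_def)
  have nonneg: "N \<ge> 0" "E \<ge> 0" "U \<ge> 0"
    using q
    by (auto simp: N_def E_def U_def W_def intro!: sum_nonneg mult_nonneg_nonneg divide_nonneg_nonneg spread_nonneg)
  have D: "\<mu> * N \<le> D" "S \<le> L * D"
    using s unfolding D_def N_def S_def in_space_def sum_distrib_left
    by (auto intro!: sum_mono progress_ge spread_le)
  have expect: "measure_pmf.expectation (fl_kernel n m F \<gamma> p q s) V
    = (\<Sum>i = 1..n. measure_pmf.expectation draws (\<lambda>j. R i (j i))) + (1 - p\<^sup>2) * E
        + 4 / q * \<gamma>\<^sup>2 * (q * S + (1 - q) * W)"
  proof -
    have "measure_pmf.expectation (fl_kernel n m F \<gamma> p q s) V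
      = measure_pmf.expectation draws (\<lambda>j. (\<Sum>i = 1..n. R i (j i)) + (1 - p\<^sup>2) * E
          + 4 / q * \<gamma>\<^sup>2 * (q * S + (1 - q) * W))"
      unfolding kernel_expectation[OF p q] V_def coin_average[OF \<gamma>(1) p(1)] R_def E_def S_def W_def ..
    then show ?thesis
      by (simp add: draws_integrable del: One_nat_def)
  qed
  have "(\<Sum>i = 1..n. measure_pmf.expectation draws (\<lambda>j. R i (j i)))
     \<le> (\<Sum>i = 1..n. (norm_d d (xs s i - zs))\<^sup>2 - 2 * \<gamma> * progress i (xs s i)
          + \<gamma>\<^sup>2 * (2 * spread i (xs s i) + 2 * spread i (ws s i)))"
  proof (intro sum_mono)
    fix i assume i: "i \<in> {1..n}"
    show "measure_pmf.expectation draws (\<lambda>j. R i (j i))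
        \<le> (norm_d d (xs s i - zs))\<^sup>2 - 2 * \<gamma> * progress i (xs s i)
          + \<gamma>\<^sup>2 * (2 * spread i (xs s i) + 2 * spread i (ws s i))"
      unfolding draws_expectation[OF i, of "R i"] unfolding R_def by (rule client_step_bound[OF i])
  qed
  also have "\<dots> = N - 2 * \<gamma> * D + \<gamma>\<^sup>2 * (2 * S + 2 * W)"
    unfolding N_def D_def S_def W_def
    by (simp only: sum.distrib sum_subtractf sum_distrib_left[symmetric])
  finally have "(\<Sum>i = 1..n. measure_pmf.expectation draws (\<lambda>j. R i (j i)))
      \<le> N - 2 * \<gamma> * D + \<gamma>\<^sup>2 * (2 * S + 2 * W)" .
  then have "measure_pmf.expectation (fl_kernel n m F \<gamma> p q s) V
      \<le> N - 2 * \<gamma> * D + \<gamma>\<^sup>2 * (2 * S + 2 * W) + (1 - p\<^sup>2) * E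
        + 4 / q * \<gamma>\<^sup>2 * (q * S + (1 - q) * W)"
    unfolding expect by (intro add_right_mono)
  also have "\<dots> = N - 2 * (\<gamma> * D) + 6 * \<gamma>\<^sup>2 * S + (1 - p\<^sup>2) * E + (1 - q / 2) * U"
  proof -
    have "q * U = 4 * \<gamma>\<^sup>2 * W"
      using q by (simp add: U_def)
    moreover have "4 / q * \<gamma>\<^sup>2 * (q * S + (1 - q) * W) = 4 * \<gamma>\<^sup>2 * S + (1 - q) * U"
      using q by (simp add: U_def distrib_left)
    ultimately show ?thesis
      by (simp add: left_diff_distrib distrib_left)
  qed
  also have "\<dots> \<le> (1 - c) * N + (1 - c) * E + (1 - c) * U"
  proof -
    (* One half of the progress 2 \<gamma> D absorbs the spread, the other half gives the decrease of N. *)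
    have "6 * \<gamma>\<^sup>2 * S \<le> 6 * \<gamma>\<^sup>2 * (L * D)"
      using D(2) by (intro mult_left_mono) auto
    also have "\<dots> = (6 * \<gamma> * L) * (\<gamma> * D)"
      by (simp add: power2_eq_square)
    also have "\<dots> \<le> 1 * (\<gamma> * D)"
    proof (intro mult_right_mono \<gamma>(2))
      have "0 \<le> \<mu> * N"
        using mu nonneg by simp
      then show "0 \<le> \<gamma> * D"
        using D(1) \<gamma>(1) by simp
    qed
    finally have 1: "6 * \<gamma>\<^sup>2 * S \<le> \<gamma> * D"
      by simp
    have "c * N \<le> (\<gamma> * \<mu>) * N"
      using c(1) nonneg by (intro mult_right_mono)
    also have "\<dots> \<le> \<gamma> * D"
      using D(1) \<gamma>(1) by simp
    finally have 2: "c * N \<le> \<gamma> * D" .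
    have 3: "(1 - p\<^sup>2) * E \<le> (1 - c) * E"
      using c(2) nonneg by (intro mult_right_mono) auto
    have 4: "(1 - q / 2) * U \<le> (1 - c) * U"
      using c(3) nonneg by (intro mult_right_mono) auto
    have "(1 - c) * N = N - c * N"
      by (simp add: left_diff_distrib)
    with 1 2 3 4 show ?thesis
      by linarith
  qed
  finally show ?thesis
    unfolding V by (simp only: distrib_left)
qed

text \<open>
  The hypotheses on the operators speak only about points of \<open>R_space d\<close>, so the contraction can be
  iterated only because the states stay there.
\<close>

lemma fl_step_in_space:
  assumes s: "in_space d n s" and j: "\<And>i. i \<in> {1..n} \<Longrightarrow> j i \<in> {1..m i}"
  shows "in_space d n (fl_step n m F \<gamma> p \<theta> \<zeta> j s)"
proof -
  have ops: "F i (j i) y c = 0" "H i y c = 0" if "i \<in> {1..n}" "y \<in> R_space d" "c \<ge> d" for i y c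
    using F_maps[OF that(1) j[OF that(1)] that(2)] client_op_in_space[OF that(1,2)] that(3)
    by (auto simp: R_space_iff)
  have comp: "xs s i c = 0" "hs s i c = 0" "ws s i c = 0"
    "F i (j i) (xs s i) c = 0" "F i (j i) (ws s i) c = 0" "H i (ws s i) c = 0"
    if "i \<in> {1..n}" "c \<ge> d" for i c
    using s that by (auto simp: in_space_def R_space_iff[symmetric] intro!: ops) (auto simp: R_space_iff)
  then show ?thesis
    unfolding in_space_def R_space_iff fl_step_def Let_def
    by (auto simp: scaleR_fun_apply fun_sum_apply intro!: sum.neutral)
qed

lemma kernel_in_space:
  assumes "in_space d n s" and "s' \<in> set_pmf (fl_kernel n m F \<gamma> p q s)"
  shows "in_space d n s'"
  using assms by (auto simp: fl_kernel_def intro!: fl_step_in_space draws_range)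


section \<open>Complexity\<close>

lemma law_finite: "finite (set_pmf (prox_skip_l_svrgda_fl n m F \<gamma> p q x0 k))"
proof (induction k)
  case (Suc k)
  then show ?case
    unfolding prox_skip_Suc by (auto simp: finite_kernel)
qed simp

lemma law_in_space:
  assumes "\<forall>i\<in>{1..n}. x0 i \<in> R_space d" and "s \<in> set_pmf (prox_skip_l_svrgda_fl n m F \<gamma> p q x0 k)"
  shows "in_space d n s"
  using assms(2)
proof (induction k arbitrary: s)
  case 0
  then show ?case
    using assms(1) by (simp add: fl_init_def in_space_def R_space_iff)
next
  case (Suc k)
  then show ?case
    unfolding prox_skip_Suc by (auto intro: kernel_in_space)
qed

lemma law_Suc_expectation:
  fixes h :: "fl_state \<Rightarrow> real"
  shows "measure_pmf.expectation (prox_skip_l_svrgda_fl n m F \<gamma> p q x0 (Suc k)) h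
    = measure_pmf.expectation (prox_skip_l_svrgda_fl n m F \<gamma> p q x0 k)
        (\<lambda>s. measure_pmf.expectation (fl_kernel n m F \<gamma> p q s) h)"
  unfolding prox_skip_Suc by (rule expectation_bind_finite[OF law_finite finite_kernel])

lemma law_integrable:
  "integrable (measure_pmf (prox_skip_l_svrgda_fl n m F \<gamma> p q x0 k)) f"
  for f :: "fl_state \<Rightarrow> real"
  by (rule integrable_measure_pmf_finite[OF law_finite])

lemma lyapunov_expectation:
  fixes \<gamma> p q c :: real
  assumes x0: "\<forall>i\<in>{1..n}. x0 i \<in> R_space d"
    and \<gamma>: "\<gamma> > 0" "6 * \<gamma> * L \<le> 1" and p: "0 < p" "p \<le> 1" and q: "0 < q" "q \<le> 1"
    and c: "c \<le> \<gamma> * \<mu>" "c \<le> p\<^sup>2" "c \<le> q / 2"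
  defines "V \<equiv> lyapunov d n m F zs \<gamma> p (4 / q)"
  shows "measure_pmf.expectation (prox_skip_l_svrgda_fl n m F \<gamma> p q x0 k) V
    \<le> (1 - c) ^ k * V (fl_init x0)"
proof (induction k)
  case (Suc k)
  have "c \<le> 1"
    using c(3) q by simp
  have "measure_pmf.expectation (prox_skip_l_svrgda_fl n m F \<gamma> p q x0 (Suc k)) V
      \<le> measure_pmf.expectation (prox_skip_l_svrgda_fl n m F \<gamma> p q x0 k) (\<lambda>s. (1 - c) * V s)"
    unfolding law_Suc_expectation V_def
    by (intro integral_mono_AE law_integrable AE_pmfI lyapunov_contraction law_in_space[OF x0] assms)
  also have "\<dots> = (1 - c) * measure_pmf.expectation (prox_skip_l_svrgda_fl n m F \<gamma> p q x0 k) V"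
    by simp
  also have "\<dots> \<le> (1 - c) * ((1 - c) ^ k * V (fl_init x0))"
    using Suc \<open>c \<le> 1\<close> by (intro mult_left_mono) auto
  finally show ?case
    unfolding power_Suc mult.assoc .
qed simp

lemma rounds_expectation:
  assumes "0 < p" "p \<le> 1" "0 < q" "q \<le> 1"
  shows "measure_pmf.expectation (prox_skip_l_svrgda_fl n m F \<gamma> p q x0 k) (\<lambda>s. real (rounds s))
    = p * real k"
proof (induction k)
  case 0
  show ?case
    by (simp add: fl_init_def)
next
  case (Suc k)
  have "measure_pmf.expectation (fl_kernel n m F \<gamma> p q s) (\<lambda>s. real (rounds s))
      = real (rounds s) + p" for s
  proof -
    have "real (rounds (fl_step n m F \<gamma> p \<theta> \<zeta> j s)) = real (rounds s) + (if \<theta> then 1 else 0)"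
      for \<theta> \<zeta> j
      by (simp add: fl_step_def Let_def)
    moreover have "p * (q * (r + 1) + (1 - q) * (r + 1)) + (1 - p) * (q * (r + 0) + (1 - q) * (r + 0))
        = r + p" for r
      by (simp add: algebra_simps)
    ultimately show ?thesis
      unfolding kernel_expectation[OF assms] by simp
  qed
  then have "measure_pmf.expectation (prox_skip_l_svrgda_fl n m F \<gamma> p q x0 (Suc k))
        (\<lambda>s. real (rounds s))
      = measure_pmf.expectation (prox_skip_l_svrgda_fl n m F \<gamma> p q x0 k) (\<lambda>s. real (rounds s) + p)"
    unfolding law_Suc_expectation by (simp only:)
  also have "\<dots> = p * real k + p"
    by (subst Bochner_Integration.integral_add) (simp_all add: law_integrable Suc)
  finally show ?case
    by (simp add: distrib_left)
qed

lemma lyapunov_nonneg: "M \<ge> 0 \<Longrightarrow> lyapunov d n m F zs \<gamma> p M s \<ge> 0"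
  by (auto simp: lyapunov_def sigma_sq_def intro!: add_nonneg_nonneg mult_nonneg_nonneg
      divide_nonneg_nonneg sum_nonneg)

text \<open>
  The choice \<open>c = \<gamma> \<mu> = p\<^sup>2 = q/2\<close> equalises the three contraction rates. From
  \<open>c K \<le> 3 ln (2 V\<^sub>0/\<epsilon>)\<close> the bound on \<open>K\<close> follows with \<open>18 = 3 * 6\<close>; dividing by \<open>p = sqrt c\<close> instead of \<open>c\<close> bounds
  the number \<open>p K\<close> of rounds, with \<open>3 * sqrt 6 \<le> 18\<close>.
\<close>

lemma complexity_bounds:
  defines "c \<equiv> \<mu> / (6 * L)"
  defines "\<gamma> \<equiv> 1 / (6 * L)" and "p \<equiv> sqrt c" and "q \<equiv> 2 * c"
  defines "V \<equiv> lyapunov d n m F zs \<gamma> p (4 / q)"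
    and "state \<equiv> prox_skip_l_svrgda_fl n m F \<gamma> p q"
  shows "\<gamma> > 0" "0 < p" "p \<le> 1" "0 < q" "q \<le> 1"
    and "\<lbrakk>\<forall>i\<in>{1..n}. x0 i \<in> R_space d; \<epsilon> > 0\<rbrakk> \<Longrightarrow> \<exists>K::nat.
      measure_pmf.expectation (state x0 K) V \<le> \<epsilon> \<and>
      real K \<le> 18 * (L / \<mu>) * max 0 (ln (2 * V (fl_init x0) / \<epsilon>)) \<and>
      measure_pmf.expectation (state x0 K) (\<lambda>s. real (rounds s)) = p * real K \<and>
      p * real K \<le> 18 * sqrt (L / \<mu>) * max 0 (ln (2 * V (fl_init x0) / \<epsilon>))"
proof -
  have L: "L > 0"
    using mu mu_le_L by simp
  have c: "0 < c" "c \<le> 1 / 6"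
    using L mu mu_le_L by (simp_all add: c_def field_simps)
  show \<gamma>: "\<gamma> > 0" and p: "0 < p" "p \<le> 1" and q: "0 < q" "q \<le> 1"
    using L c by (simp_all add: \<gamma>_def p_def q_def)
  assume x0: "\<forall>i\<in>{1..n}. x0 i \<in> R_space d" and \<epsilon>: "\<epsilon> > 0"
  define l where "l = max 0 (ln (2 * V (fl_init x0) / \<epsilon>))"
  have V0: "V (fl_init x0) \<ge> 0"
    unfolding V_def using q by (intro lyapunov_nonneg) simp
  obtain K :: nat where K: "(1 - c) ^ K * V (fl_init x0) \<le> \<epsilon>" "c * real K \<le> 3 * l"
    using contraction_iterations[of c "V (fl_init x0)" \<epsilon>] c V0 \<epsilon> unfolding l_def by auto
  have "measure_pmf.expectation (state x0 K) V \<le> (1 - c) ^ K * V (fl_init x0)"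
    unfolding state_def V_def
    by (rule lyapunov_expectation[OF x0 \<gamma> _ p q])
       (use L c in \<open>simp_all add: \<gamma>_def p_def q_def, simp add: c_def\<close>)
  then have "measure_pmf.expectation (state x0 K) V \<le> \<epsilon>"
    using K(1) by simp
  moreover have "real K \<le> 18 * (L / \<mu>) * l"
    using K(2) L mu by (simp add: c_def field_simps)
  moreover have "p * real K \<le> 18 * sqrt (L / \<mu>) * l"
  proof -
    have "p * (p * real K) \<le> 3 * l"
      using K(2) c by (simp add: p_def mult.assoc[symmetric])
    then have "p * real K \<le> 3 * l / p"
      using p by (simp add: field_simps)
    also have "\<dots> = 3 * sqrt 6 * sqrt (L / \<mu>) * l"
      unfolding p_def c_def by (simp add: real_sqrt_divide real_sqrt_mult)
    also have "\<dots> \<le> 3 * 6 * sqrt (L / \<mu>) * l"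
      using L mu by (intro mult_right_mono) (auto simp: l_def real_le_lsqrt intro!: real_le_lsqrt)
    finally show ?thesis
      by simp
  qed
  moreover have "measure_pmf.expectation (state x0 K) (\<lambda>s. real (rounds s)) = p * real K"
    unfolding state_def by (rule rounds_expectation[OF p q])
  ultimately show "\<exists>K::nat.
      measure_pmf.expectation (state x0 K) V \<le> \<epsilon> \<and>
      real K \<le> 18 * (L / \<mu>) * max 0 (ln (2 * V (fl_init x0) / \<epsilon>)) \<and>
      measure_pmf.expectation (state x0 K) (\<lambda>s. real (rounds s)) = p * real K \<and>
      p * real K \<le> 18 * sqrt (L / \<mu>) * max 0 (ln (2 * V (fl_init x0) / \<epsilon>))"
    unfolding l_def by blast
qed

end

theorem theorem5p3:
  shows "\<exists>C::real. C > 0 \<and>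
    (\<forall>(d::nat) (n::nat) (m :: nat \<Rightarrow> nat) (F :: nat \<Rightarrow> nat \<Rightarrow> rvec \<Rightarrow> rvec)
      (zs :: rvec) (\<mu>::real) (L::real).
      d \<ge> 1 \<longrightarrow> n \<ge> 1 \<longrightarrow> (\<forall>i\<in>{1..n}. m i \<ge> 1) \<longrightarrow>
      (\<forall>i\<in>{1..n}. \<forall>j\<in>{1..m i}. F i j \<in> R_space d \<rightarrow> R_space d) \<longrightarrow>
      vi_solution d (mean_op n m F) zs \<longrightarrow>
      (\<forall>z. vi_solution d (mean_op n m F) z \<longrightarrow> z = zs) \<longrightarrow>
      \<mu> > 0 \<longrightarrow>
      (\<forall>i\<in>{1..n}. quasi_strongly_monotone d \<mu> (client_op m F i) zs) \<longrightarrow>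
      (\<forall>i\<in>{1..n}. \<forall>y\<in>R_space d.
        1 / real (m i) * (\<Sum>j = 1..m i. (norm_d d (F i j y - F i j zs))\<^sup>2)
          \<le> L * inner_d d (client_op m F i y - client_op m F i zs) (y - zs)) \<longrightarrow>
      (\<exists>\<gamma> p q M :: real. \<gamma> > 0 \<and> 0 < p \<and> p \<le> 1 \<and> 0 < q \<and> q \<le> 1 \<and> M > 0 \<and>
        (\<forall>(x0 :: nat \<Rightarrow> rvec) (\<epsilon>::real).
          (\<forall>i\<in>{1..n}. x0 i \<in> R_space d) \<longrightarrow> \<epsilon> > 0 \<longrightarrow>
          (let V = lyapunov d n m F zs \<gamma> p M;
               state = prox_skip_l_svrgda_fl n m F \<gamma> p q x0;
               log_term = max 0 (ln (2 * V (fl_init x0) / \<epsilon>))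
           in \<exists>K::nat.
                measure_pmf.expectation (state K) V \<le> \<epsilon> \<and>
                real K \<le> C * (L / \<mu>) * log_term \<and>
                measure_pmf.expectation (state K) (\<lambda>s. real (rounds s)) = p * real K \<and>
                p * real K \<le> C * sqrt (L / \<mu>) * log_term))))"
proof (rule exI[of _ 18], intro conjI allI impI)
  show "(18 :: real) > 0"
    by simp
next
  fix d n m F zs \<mu> L
  assume "d \<ge> 1" "n \<ge> 1" "\<forall>i\<in>{1..n}. m i \<ge> 1"
    "\<forall>i\<in>{1..n}. \<forall>j\<in>{1..m i}. F i j \<in> R_space d \<rightarrow> R_space d"
    "vi_solution d (mean_op n m F) zs" "\<mu> > 0"
    "\<forall>i\<in>{1..n}. quasi_strongly_monotone d \<mu> (client_op m F i) zs"
    "\<forall>i\<in>{1..n}. \<forall>y\<in>R_space d.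
        1 / real (m i) * (\<Sum>j = 1..m i. (norm_d d (F i j y - F i j zs))\<^sup>2)
          \<le> L * inner_d d (client_op m F i y - client_op m F i zs) (y - zs)"
  then interpret federated_vi d n m F zs \<mu> L
    by unfold_locales blast+
  let ?c = "\<mu> / (6 * L)"
  show "\<exists>\<gamma> p q M :: real. \<gamma> > 0 \<and> 0 < p \<and> p \<le> 1 \<and> 0 < q \<and> q \<le> 1 \<and> M > 0 \<and>
        (\<forall>(x0 :: nat \<Rightarrow> rvec) (\<epsilon>::real).
          (\<forall>i\<in>{1..n}. x0 i \<in> R_space d) \<longrightarrow> \<epsilon> > 0 \<longrightarrow>
          (let V = lyapunov d n m F zs \<gamma> p M;
               state = prox_skip_l_svrgda_fl n m F \<gamma> p q x0;
               log_term = max 0 (ln (2 * V (fl_init x0) / \<epsilon>))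
           in \<exists>K::nat.
                measure_pmf.expectation (state K) V \<le> \<epsilon> \<and>
                real K \<le> 18 * (L / \<mu>) * log_term \<and>
                measure_pmf.expectation (state K) (\<lambda>s. real (rounds s)) = p * real K \<and>
                p * real K \<le> 18 * sqrt (L / \<mu>) * log_term))"
    unfolding Let_def
    by (rule exI[of _ "1 / (6 * L)"], rule exI[of _ "sqrt ?c"], rule exI[of _ "2 * ?c"],
        rule exI[of _ "4 / (2 * ?c)"])
       (intro conjI allI impI complexity_bounds divide_pos_pos zero_less_numeral)
qed

end
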